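(* Let $n\ge 2$, let $O$ be a point outside a smooth closed convex set $\mathcal D\subset\mathbb R^n$ with nonempty interior, and suppose the segment $[A^*B^*]$ is a local maximizer for $G$ which intersects the interior of $\mathcal D$. Let $\Pi_1$ and $\Pi_2$ be the only hyperplanes supporting $\mathcal D$ at $A^*$ and $B^*$, respectively. Then the normal line to $\Pi_1$ at $A^*$ and the normal line to $\Pi_2$ at $B^*$ intersect at a point belonging to the hyperplane through $O$ which is orthogonal to the line $A^*B^*$.
   Context: $\partial\mathcal D$ is the boundary of $\mathcal D$; $|AB|$ is the Euclidean length of $[AB]$. For a closed convex set $\mathcal D$ with nonempty interior and a point $O\notin\mathcal D$, consider all segments $[AB]$ with end-points $A,B\in\partial\mathcal D$ such that the line $AB$ passes through $O$ and $B\in[OA]$; put $G([AB])=|AB|$ for such segments. Such a segment $[A^*B^*]$ is a local maximizer for $G$ if there are open sets $U\ni A^*$ and $V\ni B^*$ such that $|AB|\le|A^*B^*|$ for every such segment $[AB]$ with $A\in\partial\mathcal D\cap U$ and $B\in\partial\mathcal D\cap V$. A hyperplane $\Pi$ supports $\mathcal D$ at $A\in\mathcal D$ if $A\in\Pi$ and $\mathcal D$ is contained in one of the two closed half-spaces determined by $\Pi$. A convex set with nonempty interior is smooth if there is only one supporting hyperplane at every point of its boundary. "The normal lines intersect at a point belonging to a hyperplane" means that there is a point common to both normal lines and the hyperplane (the two normal lines are allowed to coincide). *)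

theory Defs
  imports "HOL-Analysis.Analysis"
begin

definition supports :: "'a::euclidean_space set \<Rightarrow> 'a set \<Rightarrow> 'a \<Rightarrow> bool" where
  "supports H D A \<longleftrightarrow> A \<in> D \<and> A \<in> H \<and>
     (\<exists>a b. a \<noteq> 0 \<and> H = {x. a \<bullet> x = b} \<and> (D \<subseteq> {x. a \<bullet> x \<le> b} \<or> D \<subseteq> {x. a \<bullet> x \<ge> b}))"

definition smooth_body :: "'a::euclidean_space set \<Rightarrow> bool" where
  "smooth_body D \<longleftrightarrow> convex D \<and> interior D \<noteq> {} \<and> (\<forall>A \<in> frontier D. \<exists>!H. supports H D A)"

text \<open>The endpoints are ordered: \<open>B\<close> is the one nearer to \<open>P\<close>. If \<open>A = B\<close>, then the affine
  hull is \<open>{A}\<close>, so for closed \<open>D\<close> and \<open>P \<notin> D\<close> only nondegenerate segments qualify.\<close>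

definition chord_from :: "'a::euclidean_space set \<Rightarrow> 'a \<Rightarrow> 'a \<Rightarrow> 'a \<Rightarrow> bool" where
  "chord_from D P A B \<longleftrightarrow> A \<in> frontier D \<and> B \<in> frontier D \<and>
     P \<in> affine hull {A, B} \<and> B \<in> closed_segment P A"

definition local_maximizer :: "'a::euclidean_space set \<Rightarrow> 'a \<Rightarrow> 'a \<Rightarrow> 'a \<Rightarrow> bool" where
  "local_maximizer D P A' B' \<longleftrightarrow> chord_from D P A' B' \<and>
     (\<exists>U V. open U \<and> open V \<and> A' \<in> U \<and> B' \<in> V \<and>
        (\<forall>A \<in> frontier D \<inter> U. \<forall>B \<in> frontier D \<inter> V.
           chord_from D P A B \<longrightarrow> dist A B \<le> dist A' B'))"

text \<open>The points \<open>x\<close> for which \<open>x - A\<close> is orthogonal to every direction of \<open>H\<close>;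
  a line whenever \<open>H\<close> is a hyperplane.\<close>

definition normal_line :: "'a::euclidean_space set \<Rightarrow> 'a \<Rightarrow> 'a set" where
  "normal_line H A = {x. \<forall>p \<in> H. \<forall>q \<in> H. orthogonal (x - A) (p - q)}"

lemma normal_line_hyperplane:
  fixes a :: "'a::euclidean_space"
  assumes "a \<noteq> 0"
  shows "normal_line {x. a \<bullet> x = b} A = range (\<lambda>t. A + t *\<^sub>R a)"
proof (intro equalityI subsetI)
  fix x assume x: "x \<in> normal_line {x. a \<bullet> x = b} A"
  define v where "v = x - A"
  define c where "c = (a \<bullet> v) / (a \<bullet> a)"
  define w where "w = v - c *\<^sub>R a"
  have aw: "a \<bullet> w = 0"
    using assms by (simp add: w_def c_def inner_diff_right)
  define q where "q = (b / (a \<bullet> a)) *\<^sub>R a"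
  have "a \<bullet> q = b" "a \<bullet> (q + w) = b"
    using assms aw by (simp_all add: q_def inner_add_right)
  then have "orthogonal v (q + w - q)"
    using x unfolding normal_line_def v_def by blast
  then have "v \<bullet> w = 0" by (simp add: orthogonal_def)
  moreover have "v = w + c *\<^sub>R a" by (simp add: w_def)
  ultimately have "w \<bullet> w = 0"
    using aw by (simp add: inner_add_left)
  then have "w = 0" by simp
  then have "x = A + c *\<^sub>R a" by (simp add: w_def v_def algebra_simps)
  then show "x \<in> range (\<lambda>t. A + t *\<^sub>R a)" by blast
next
  fix x assume "x \<in> range (\<lambda>t. A + t *\<^sub>R a)"
  then show "x \<in> normal_line {x. a \<bullet> x = b} A"
    by (auto simp: normal_line_def orthogonal_def inner_diff_right)
qed

definition orthogonal_hyperplane :: "'a::euclidean_space \<Rightarrow> 'a \<Rightarrow> 'a \<Rightarrow> 'a set" where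
  "orthogonal_hyperplane P A B = {x. orthogonal (x - P) (A - B)}"

end

theory Submission
  imports Defs
begin

text \<open>Put \<open>u = A - P\<close> and \<open>B = P + \<beta> u\<close>, and scale the normals to \<open>a\<close>, \<open>b\<close> with
  \<open>a \<bullet> u = b \<bullet> u = 1\<close>. Turn the line to the direction \<open>u + \<epsilon> w\<close> with \<open>w\<close> orthogonal to \<open>u\<close>.
  Smoothness says that the tangent cone at a boundary point is a full half-space, so the turned
  line leaves \<open>D\<close> at the parameters \<open>1 - \<epsilon> (a \<bullet> w) + o(\<epsilon>)\<close> and
  \<open>\<beta> (1 - \<epsilon> (b \<bullet> w)) + o(\<epsilon>)\<close>, and the length of the chord grows at the rate
  \<open>(\<beta> b - a) \<bullet> w\<close> (times the norm of \<open>u\<close>). Maximality forces the component of \<open>\<beta> b - a\<close>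
  orthogonal to \<open>u\<close> to vanish, which is the concurrency claim.\<close>

lemma supports_outward_normal:
  assumes "supports H D A"
  obtains a where "a \<noteq> 0" "H = {x. a \<bullet> x = a \<bullet> A}" "D \<subseteq> {x. a \<bullet> x \<le> a \<bullet> A}"
proof -
  obtain a b where ab: "a \<noteq> 0" "H = {x. a \<bullet> x = b}" "A \<in> H"
    "D \<subseteq> {x. a \<bullet> x \<le> b} \<or> D \<subseteq> {x. a \<bullet> x \<ge> b}"
    using assms unfolding supports_def by blast
  have b: "b = a \<bullet> A" using ab by simp
  from ab(4) show thesis
  proof
    assume "D \<subseteq> {x. a \<bullet> x \<le> b}"
    then show thesis using that[of a] ab b by simp
  next
    assume "D \<subseteq> {x. a \<bullet> x \<ge> b}"
    then show thesis using that[of "- a"] ab b by auto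
  qed
qed

lemma interior_subset_open_halfspace:
  fixes a :: "'a::euclidean_space"
  assumes "D \<subseteq> {x. a \<bullet> x \<le> b}" "a \<noteq> 0" "x \<in> interior D"
  shows "a \<bullet> x < b"
  using interior_mono[OF assms(1)] interior_halfspace_le[OF assms(2), of b] assms(3) by auto

text \<open>If the open ray from \<open>A\<close> along \<open>v\<close> missed the interior, a
  hyperplane separating the two would support \<open>D\<close> at \<open>A\<close>. Smoothness makes
  it the hyperplane of \<open>a\<close>, yet \<open>v\<close> points strictly to the inner side of
  that one. So the ray meets \<open>D\<close>, and convexity fills in the segment back to
  \<open>A\<close>.\<close>

lemma smooth_body_inward_segment:
  fixes D :: "'a::euclidean_space set"
  assumes "closed D" "smooth_body D" "A \<in> frontier D"
    and a: "a \<noteq> 0" "D \<subseteq> {x. a \<bullet> x \<le> a \<bullet> A}"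
    and v: "a \<bullet> v < 0"
  obtains t0 where "t0 > 0" "\<And>t. 0 \<le> t \<Longrightarrow> t \<le> t0 \<Longrightarrow> A + t *\<^sub>R v \<in> D"
proof -
  have cD: "convex D" and iD: "interior D \<noteq> {}"
    and uniq: "\<And>H H'. supports H D A \<Longrightarrow> supports H' D A \<Longrightarrow> H = H'"
    using assms(2,3) unfolding smooth_body_def by blast+
  have AD: "A \<in> D" using assms(1,3) frontier_subset_closed by blast
  define R where "R = (\<lambda>t. A + t *\<^sub>R v) ` {0<..}"
  have "R \<inter> interior D \<noteq> {}"
  proof
    assume disj: "R \<inter> interior D = {}"
    have "R = (+) A ` (\<lambda>t. t *\<^sub>R v) ` {0<..}"
      unfolding R_def by (simp add: image_image)
    moreover have "convex ((\<lambda>t. t *\<^sub>R v) ` {0<..})"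
      by (intro convex_linear_image) (auto intro: linearI simp: scaleR_left_distrib)
    ultimately have "convex R" by (simp add: convex_translation)
    moreover have "R \<noteq> {}" by (auto simp: R_def)
    ultimately obtain c k where ck: "c \<noteq> 0" "\<And>x. x \<in> interior D \<Longrightarrow> c \<bullet> x \<le> k"
      "\<And>x. x \<in> R \<Longrightarrow> c \<bullet> x \<ge> k"
      using separating_hyperplane_sets[of "interior D" R] iD cD disj
      by (metis Int_commute convex_interior)
    have "D \<subseteq> closure (interior D)"
      using convex_closure_interior[OF cD iD] closure_subset by blast
    also have "\<dots> \<subseteq> {x. c \<bullet> x \<le> k}"
      by (rule closure_minimal) (use ck(2) in \<open>auto simp: closed_halfspace_le\<close>)
    finally have Dk: "D \<subseteq> {x. c \<bullet> x \<le> k}" .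
    have ray: "k \<le> c \<bullet> A + t * (c \<bullet> v)" if "t > 0" for t
      using ck(3)[of "A + t *\<^sub>R v"] that by (auto simp: R_def inner_add_right)
    \<comment> \<open>Letting \<open>t\<close> tend to 0 carries the bound over to the origin of the
      ray, so the separating hyperplane passes through \<open>A\<close>.\<close>
    have "((\<lambda>t. c \<bullet> A + t * (c \<bullet> v)) \<longlongrightarrow> c \<bullet> A + 0 * (c \<bullet> v)) (at_right 0)"
      by (intro tendsto_intros)
    then have "k \<le> c \<bullet> A + 0 * (c \<bullet> v)"
      by (rule tendsto_lowerbound)
        (auto intro: ray eventually_at_right_less eventually_mono[OF eventually_at_right_less])
    then have k: "k = c \<bullet> A" using AD Dk by auto
    then have cv: "c \<bullet> v \<ge> 0" using ray[of 1] by simp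
    have "supports {x. c \<bullet> x = k} D A" "supports {x. a \<bullet> x = a \<bullet> A} D A"
      unfolding supports_def using AD ck(1) Dk k a by blast+
    then have eq: "{x. c \<bullet> x = k} = {x. a \<bullet> x = a \<bullet> A}" by (rule uniq)
    \<comment> \<open>Equality of the hyperplanes leaves the relative sign of \<open>a\<close> and
      \<open>c\<close> open; an interior point settles it, since both are negative on
      \<open>y\<close>.\<close>
    obtain z where z: "z \<in> interior D" using iD by blast
    define y where "y = z - A"
    have ay: "a \<bullet> y < 0" and cy: "c \<bullet> y < 0"
      using interior_subset_open_halfspace[OF a(2,1) z]
        interior_subset_open_halfspace[OF Dk ck(1) z] k
      by (auto simp: y_def inner_diff_right)
    \<comment> \<open>Subtracting this multiple of \<open>y\<close> cancels the
      \<open>a\<close>-component of \<open>v\<close>, so \<open>y'\<close> is parallel to the common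
      hyperplane and \<open>c\<close> vanishes on it as well.\<close>
    define y' where "y' = v - ((a \<bullet> v) / (a \<bullet> y)) *\<^sub>R y"
    have "a \<bullet> y' = 0" using ay by (simp add: y'_def inner_diff_right)
    then have "A + y' \<in> {x. c \<bullet> x = k}" unfolding eq by (simp add: inner_add_right)
    then have "c \<bullet> y' = 0" using k by (simp add: inner_add_right)
    then have "c \<bullet> v = ((a \<bullet> v) / (a \<bullet> y)) * (c \<bullet> y)" by (simp add: y'_def inner_diff_right)
    also have "\<dots> < 0" using divide_neg_neg[OF v ay] cy by (rule mult_pos_neg)
    finally show False using cv by simp
  qed
  then obtain t0 where t0: "t0 > 0" "A + t0 *\<^sub>R v \<in> D"
    unfolding R_def using interior_subset by blast
  show thesis
  proof (rule that[OF t0(1)])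
    fix t assume t: "0 \<le> t" "t \<le> t0"
    have "(1 - t / t0) *\<^sub>R A + (t / t0) *\<^sub>R (A + t0 *\<^sub>R v) \<in> D"
      by (rule convexD_alt[OF cD AD t0(2)]) (use t t0 in auto)
    then show "A + t *\<^sub>R v \<in> D" using t0 by (simp add: algebra_simps)
  qed
qed

text \<open>The endpoint \<open>y\<close> need only avoid the interior because it will be taken on a
  supporting hyperplane, which may touch \<open>D\<close> there; then \<open>y\<close> itself is the
  frontier point. Otherwise connectedness of the segment gives a crossing.\<close>

lemma closed_segment_Int_frontier:
  fixes D :: "'a::real_normed_vector set"
  assumes "x \<in> D" "y \<notin> interior D"
  shows "closed_segment x y \<inter> frontier D \<noteq> {}"
proof (cases "y \<in> D")
  case True
  then have "y \<in> frontier D" using assms closure_subset by (auto simp: frontier_def)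
  then show ?thesis by auto
next
  case False
  then show ?thesis using assms(1) by (intro connected_Int_frontier) auto
qed

lemma eventually_one_plus_mult_pos:
  fixes k :: real
  shows "\<forall>\<^sub>F \<epsilon> in at_right 0. 1 + \<epsilon> * k > 0"
proof -
  have "((\<lambda>\<epsilon>. 1 + \<epsilon> * k) \<longlongrightarrow> 1 + 0 * k) (at_right 0)" by (intro tendsto_intros)
  then show ?thesis by (rule order_tendstoD) simp
qed

text \<open>The point with parameter \<open>\<beta> / (1 + \<epsilon> c)\<close> lies on the inward segment with direction
  \<open>w - c u\<close>, the one with parameter \<open>\<beta> / (1 + \<epsilon> p)\<close> on the supporting hyperplane. The sign of
  \<open>a \<bullet> u\<close> is left open, so that the lemma applies to both ends of the chord.\<close>

lemma eventually_frontier_on_turned_line: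
  fixes D :: "'a::euclidean_space set"
  assumes "closed D" "smooth_body D" "P + \<beta> *\<^sub>R u \<in> frontier D" "\<beta> > 0"
    and a: "D \<subseteq> {x. a \<bullet> x \<le> a \<bullet> (P + \<beta> *\<^sub>R u)}" "a \<bullet> u \<noteq> 0"
    and c: "a \<bullet> (w - c *\<^sub>R u) < 0"
    and U: "open U" "P + \<beta> *\<^sub>R u \<in> U"
  defines "p \<equiv> (a \<bullet> w) / (a \<bullet> u)"
  shows "\<forall>\<^sub>F \<epsilon> in at_right 0. \<exists>r \<in> closed_segment (\<beta> / (1 + \<epsilon> * c)) (\<beta> / (1 + \<epsilon> * p)).
    P + r *\<^sub>R (u + \<epsilon> *\<^sub>R w) \<in> frontier D \<inter> U"
proof -
  define X where "X = P + \<beta> *\<^sub>R u"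
  define pt where "pt = (\<lambda>k \<epsilon>. P + (\<beta> / (1 + \<epsilon> * k)) *\<^sub>R (u + \<epsilon> *\<^sub>R w))"
  have a0: "a \<noteq> 0" using a(2) by auto
  obtain t0 where t0: "t0 > 0" "\<And>t. 0 \<le> t \<Longrightarrow> t \<le> t0 \<Longrightarrow> X + t *\<^sub>R (w - c *\<^sub>R u) \<in> D"
    using smooth_body_inward_segment[OF assms(1-3) a0 a(1) c] unfolding X_def by metis
  \<comment> \<open>A ball is convex, so the whole segment between two nearby points stays in
    \<open>U\<close>.\<close>
  obtain e where e: "e > 0" "ball X e \<subseteq> U"
    using U unfolding X_def open_contains_ball by blast
  have near: "\<forall>\<^sub>F \<epsilon> in at_right 0. pt k \<epsilon> \<in> ball X e" for k
  proof -
    have "(pt k \<longlongrightarrow> P + (\<beta> / (1 + 0 * k)) *\<^sub>R (u + 0 *\<^sub>R w)) (at_right 0)"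
      unfolding pt_def by (intro tendsto_intros) simp
    then have "(pt k \<longlongrightarrow> X) (at_right 0)" by (simp add: X_def)
    then show ?thesis by (rule topological_tendstoD) (use e in auto)
  qed
  have small: "\<forall>\<^sub>F \<epsilon> in at_right 0. \<beta> * \<epsilon> / (1 + \<epsilon> * c) < t0"
  proof -
    have "((\<lambda>\<epsilon>. \<beta> * \<epsilon> / (1 + \<epsilon> * c)) \<longlongrightarrow> \<beta> * 0 / (1 + 0 * c)) (at_right 0)"
      by (intro tendsto_intros) simp
    then show ?thesis by (rule order_tendstoD) (use t0 in simp)
  qed
  have gt0: "\<forall>\<^sub>F \<epsilon> in at_right (0::real). 0 < \<epsilon>" by (rule eventually_at_right_less)
  show ?thesis
    using eventually_one_plus_mult_pos[of c] eventually_one_plus_mult_pos[of p]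
      near[of c] near[of p] small gt0
  proof eventually_elim
    case (elim \<epsilon>)
    \<comment> \<open>This step length makes the coefficient of \<open>w\<close> equal to \<epsilon>
      times that of \<open>u\<close>, which puts the point on the turned line.\<close>
    have "X + (\<beta> * \<epsilon> / (1 + \<epsilon> * c)) *\<^sub>R (w - c *\<^sub>R u) \<in> D"
      using elim \<open>\<beta> > 0\<close> by (intro t0(2)) auto
    moreover have "\<beta> - \<beta> * \<epsilon> / (1 + \<epsilon> * c) * c = \<beta> / (1 + \<epsilon> * c)"
      using elim by (simp add: field_simps)
    then have "pt c \<epsilon> = P + (\<beta> - \<beta> * \<epsilon> / (1 + \<epsilon> * c) * c) *\<^sub>R u + (\<beta> * \<epsilon> / (1 + \<epsilon> * c)) *\<^sub>R w"
      by (simp add: pt_def scaleR_add_right)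
    then have "pt c \<epsilon> = X + (\<beta> * \<epsilon> / (1 + \<epsilon> * c)) *\<^sub>R (w - c *\<^sub>R u)"
      by (simp add: X_def scaleR_diff_left scaleR_diff_right)
    ultimately have inD: "pt c \<epsilon> \<in> D" by simp
    have "a \<bullet> (u + \<epsilon> *\<^sub>R w) = (1 + \<epsilon> * p) * (a \<bullet> u)"
      using a(2) by (simp add: p_def inner_add_right field_simps)
    then have "a \<bullet> pt p \<epsilon> = a \<bullet> X"
      using elim by (simp add: pt_def X_def inner_add_right)
    then have "pt p \<epsilon> \<notin> interior D"
      using interior_subset_open_halfspace[OF a(1) a0] unfolding X_def by fastforce
    then obtain x where x: "x \<in> closed_segment (pt c \<epsilon>) (pt p \<epsilon>)" "x \<in> frontier D"
      using closed_segment_Int_frontier[OF inD] by blast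
    have "x \<in> U"
      using x(1) closed_segment_subset[OF elim(3,4)] e by auto
    obtain t where t: "0 \<le> t" "t \<le> 1" "x = (1 - t) *\<^sub>R pt c \<epsilon> + t *\<^sub>R pt p \<epsilon>"
      using x(1) by (auto simp: in_segment)
    \<comment> \<open>The parameter is a convex combination of the two bounds. Their order depends
      on the sign of \<open>a \<bullet> u\<close>, and a real \<open>closed_segment\<close> covers
      both orders.\<close>
    define r where "r = (1 - t) *\<^sub>R (\<beta> / (1 + \<epsilon> * c)) + t *\<^sub>R (\<beta> / (1 + \<epsilon> * p))"
    have "r \<in> closed_segment (\<beta> / (1 + \<epsilon> * c)) (\<beta> / (1 + \<epsilon> * p))"
      using t by (auto simp: in_segment r_def)
    moreover have "x = P + r *\<^sub>R (u + \<epsilon> *\<^sub>R w)"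
      unfolding t(3) pt_def r_def by (simp only: real_scaleR_def) (simp add: algebra_simps)
    ultimately show ?case using x(2) \<open>x \<in> U\<close> by blast
  qed
qed

lemma chord_from_on_ray:
  assumes "P + r *\<^sub>R z \<in> frontier D" "P + s *\<^sub>R z \<in> frontier D" "0 < s" "s < r"
  shows "chord_from D P (P + r *\<^sub>R z) (P + s *\<^sub>R z)"
proof -
  \<comment> \<open>Affine weights for which the multiples of \<open>z\<close> cancel.\<close>
  have sum1: "- s / (r - s) + r / (r - s) = 1"
    using assms by (simp add: diff_divide_distrib[symmetric])
  have "(- s / (r - s)) *\<^sub>R (P + r *\<^sub>R z) + (r / (r - s)) *\<^sub>R (P + s *\<^sub>R z)
      = (- s / (r - s) + r / (r - s)) *\<^sub>R P + (- s / (r - s) * r + r / (r - s) * s) *\<^sub>R z"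
    by (simp only: scaleR_add_right scaleR_add_left scaleR_scaleR) (simp add: algebra_simps)
  also have "\<dots> = P" unfolding sum1 by simp
  finally have "P \<in> affine hull {P + r *\<^sub>R z, P + s *\<^sub>R z}"
    using sum1 unfolding affine_hull_2 mem_Collect_eq by metis
  moreover have "P + s *\<^sub>R z \<in> closed_segment P (P + r *\<^sub>R z)"
    unfolding in_segment
    by (rule exI[of _ "s / r"]) (use assms in \<open>auto simp: algebra_simps\<close>)
  ultimately show ?thesis using assms unfolding chord_from_def by blast
qed

text \<open>At \<epsilon> = 0 the left side equals \<open>1 - \<beta>\<close> and has derivative
  \<open>\<beta> * d - c\<close>. The proof clears the positive denominators instead of
  differentiating.\<close>

lemma eventually_chord_growth:
  fixes \<beta> c d :: real
  assumes "\<beta> * d > c"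
  shows "\<forall>\<^sub>F \<epsilon> in at_right 0. 1 / (1 + \<epsilon> * c) - \<beta> / (1 + \<epsilon> * d) > 1 - \<beta>"
proof -
  have "((\<lambda>\<epsilon>. \<beta> * d - c - (1 - \<beta>) * \<epsilon> * c * d) \<longlongrightarrow> \<beta> * d - c - (1 - \<beta>) * 0 * c * d) (at_right 0)"
    by (intro tendsto_intros)
  then have "\<forall>\<^sub>F \<epsilon> in at_right 0. \<beta> * d - c - (1 - \<beta>) * \<epsilon> * c * d > 0"
    by (rule order_tendstoD) (use assms in simp)
  moreover note eventually_one_plus_mult_pos[of c] eventually_one_plus_mult_pos[of d]
  moreover have "\<forall>\<^sub>F \<epsilon> in at_right (0::real). 0 < \<epsilon>" by (rule eventually_at_right_less)
  ultimately show ?thesis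
  proof eventually_elim
    case (elim \<epsilon>)
    have "0 < \<epsilon> * (\<beta> * d - c - (1 - \<beta>) * \<epsilon> * c * d)" using elim by simp
    also have "\<dots> = (1 + \<epsilon> * d) - \<beta> * (1 + \<epsilon> * c) - (1 - \<beta>) * ((1 + \<epsilon> * c) * (1 + \<epsilon> * d))"
      by (simp add: algebra_simps)
    finally have "(1 - \<beta>) * ((1 + \<epsilon> * c) * (1 + \<epsilon> * d)) < (1 + \<epsilon> * d) - \<beta> * (1 + \<epsilon> * c)"
      by simp
    then have "1 - \<beta> < ((1 + \<epsilon> * d) - \<beta> * (1 + \<epsilon> * c)) / ((1 + \<epsilon> * c) * (1 + \<epsilon> * d))"
      using elim by (subst pos_less_divide_eq) auto
    also have "\<dots> = 1 / (1 + \<epsilon> * c) - \<beta> / (1 + \<epsilon> * d)"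
      using elim by (simp add: diff_divide_distrib)
    finally show ?case .
  qed
qed

theorem theorem25:
  fixes D \<Pi>1 \<Pi>2 :: "(real ^ 'n) set" and P A B :: "real ^ 'n"
  assumes "CARD('n) \<ge> 2"
    and "closed D" and "convex D" and "interior D \<noteq> {}" and "smooth_body D"
    and "P \<notin> D"
    and "local_maximizer D P A B"
    and "closed_segment A B \<inter> interior D \<noteq> {}"
    and "supports \<Pi>1 D A" and "supports \<Pi>2 D B"
  shows "normal_line \<Pi>1 A \<inter> normal_line \<Pi>2 B \<inter> orthogonal_hyperplane P A B \<noteq> {}"
proof -
  obtain U V where UV: "open U" "open V" "A \<in> U" "B \<in> V"
    and max: "\<And>A' B'. \<lbrakk>A' \<in> frontier D \<inter> U; B' \<in> frontier D \<inter> V; chord_from D P A' B'\<rbrakk>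
      \<Longrightarrow> dist A' B' \<le> dist A B"
    and ch: "chord_from D P A B"
    using assms(7) unfolding local_maximizer_def by blast
  have fr: "A \<in> frontier D" "B \<in> frontier D" and seg: "B \<in> closed_segment P A"
    using ch by (auto simp: chord_from_def)
  obtain m where m: "m \<in> closed_segment A B" "m \<in> interior D" using assms(8) by blast
  define u where "u = A - P"
  \<comment> \<open>The factor 1 gives \<open>A\<close> the same form as \<open>B\<close>, so that
    one lemma serves both ends.\<close>
  have A: "A = P + 1 *\<^sub>R u" by (simp add: u_def)
  obtain \<beta> where \<beta>: "0 \<le> \<beta>" "\<beta> \<le> 1" "B = (1 - \<beta>) *\<^sub>R P + \<beta> *\<^sub>R A"
    using seg by (auto simp: in_segment)
  have B: "B = P + \<beta> *\<^sub>R u" by (simp add: \<beta>(3) u_def algebra_simps)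
  have "B \<noteq> P" using fr assms(2,6) frontier_subset_closed by blast
  moreover have "A \<noteq> B" using m fr by (auto simp: frontier_def)
  ultimately have \<beta>': "0 < \<beta>" "\<beta> < 1"
    using \<beta> B A by (auto simp: less_le)
  obtain a where a: "a \<noteq> 0" "\<Pi>1 = {x. a \<bullet> x = a \<bullet> A}" "D \<subseteq> {x. a \<bullet> x \<le> a \<bullet> A}"
    using supports_outward_normal[OF assms(9)] .
  obtain b where b: "b \<noteq> 0" "\<Pi>2 = {x. b \<bullet> x = b \<bullet> B}" "D \<subseteq> {x. b \<bullet> x \<le> b \<bullet> B}"
    using supports_outward_normal[OF assms(10)] .
  obtain t where t: "0 \<le> t" "t \<le> 1" "m = (1 - t) *\<^sub>R A + t *\<^sub>R B"
    using m(1) by (auto simp: in_segment)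
  \<comment> \<open>The interior point \<open>m\<close> on the chord makes both support inequalities
    strict: \<open>u\<close> points out of \<open>D\<close> at \<open>A\<close> and into
    \<open>D\<close> at \<open>B\<close>.\<close>
  have au: "a \<bullet> u > 0"
  proof -
    have "m = A - (t * (1 - \<beta>)) *\<^sub>R u" by (simp add: t(3) A B algebra_simps)
    then have "(t * (1 - \<beta>)) * (a \<bullet> u) > 0"
      using interior_subset_open_halfspace[OF a(3,1) m(2)] by (simp add: inner_diff_right)
    moreover have "t * (1 - \<beta>) \<ge> 0" using t \<beta>' by simp
    ultimately show ?thesis by (auto simp: zero_less_mult_iff)
  qed
  have bu: "b \<bullet> u < 0"
  proof -
    have "m = B + ((1 - t) * (1 - \<beta>)) *\<^sub>R u" by (simp add: t(3) A B algebra_simps)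
    then have "((1 - t) * (1 - \<beta>)) * (b \<bullet> u) < 0"
      using interior_subset_open_halfspace[OF b(3,1) m(2)] by (simp add: inner_add_right)
    then show ?thesis using t \<beta>' by (simp add: mult_less_0_iff)
  qed
  define N where "N = u \<bullet> u"
  have "u \<noteq> 0" using au by auto
  then have N: "N > 0" by (simp add: N_def)
  define a' where "a' = (1 / (a \<bullet> u)) *\<^sub>R a"
  define b' where "b' = (1 / (b \<bullet> u)) *\<^sub>R b"
  have a'u: "a' \<bullet> u = 1" and b'u: "b' \<bullet> u = 1" using au bu by (simp_all add: a'_def b'_def)
  \<comment> \<open>Since \<open>(\<beta> *\<^sub>R b' - a') \<bullet> u = \<beta> - 1\<close>, this
    is the component of \<open>\<beta> *\<^sub>R b' - a'\<close> orthogonal to \<open>u\<close>.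
    Turning along it gives the growth rate \<open>w \<bullet> w\<close>.\<close>
  define w where "w = \<beta> *\<^sub>R b' - a' + ((1 - \<beta>) / N) *\<^sub>R u"
  have uw: "u \<bullet> w = 0"
    using a'u b'u N by (simp add: w_def inner_diff_right inner_add_right inner_commute N_def[symmetric])
  define p where "p = (a \<bullet> w) / (a \<bullet> u)"
  define q where "q = (b \<bullet> w) / (b \<bullet> u)"
  have "w \<bullet> w = (\<beta> *\<^sub>R b' - a' + ((1 - \<beta>) / N) *\<^sub>R u) \<bullet> w" by (simp flip: w_def)
  also have "\<dots> = \<beta> * q - p"
    using uw by (simp add: inner_add_left inner_diff_left a'_def b'_def p_def q_def)
  finally have ww: "w \<bullet> w = \<beta> * q - p" .
  have w0: "w = 0"
  proof (rule ccontr)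
    assume "w \<noteq> 0"
    then have wpos: "w \<bullet> w > 0" by simp
    \<comment> \<open>Moving \<open>p\<close> and \<open>q\<close> by \<eta> costs
      \<open>(1 + \<beta>) * \<eta>\<close> of the rate; half of \<open>w \<bullet> w\<close> is
      affordable because \<beta> < 1.\<close>
    define \<eta> where "\<eta> = (w \<bullet> w) / 2"
    have \<eta>: "\<eta> > 0" using wpos by (simp add: \<eta>_def)
    define c where "c = p + \<eta>"
    define d where "d = q - \<eta>"
    have "\<beta> * d - c = (1 - \<beta>) * \<eta>" using ww by (simp add: c_def d_def \<eta>_def algebra_simps)
    also have "\<dots> > 0" using \<eta> \<beta>' by simp
    finally have dc: "\<beta> * d > c" by simp
    have "a \<bullet> (w - c *\<^sub>R u) = - \<eta> * (a \<bullet> u)"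
      using au by (simp add: inner_diff_right c_def p_def field_simps)
    also have "\<dots> < 0" using au \<eta> by simp
    finally have ac: "a \<bullet> (w - c *\<^sub>R u) < 0" .
    have "b \<bullet> (w - d *\<^sub>R u) = \<eta> * (b \<bullet> u)"
      using bu by (simp add: inner_diff_right d_def q_def field_simps)
    also have "\<dots> < 0" using bu \<eta> by (simp add: mult_pos_neg)
    finally have bd: "b \<bullet> (w - d *\<^sub>R u) < 0" .
    have evA: "\<forall>\<^sub>F \<epsilon> in at_right 0. \<exists>r \<in> closed_segment (1 / (1 + \<epsilon> * c)) (1 / (1 + \<epsilon> * p)).
        P + r *\<^sub>R (u + \<epsilon> *\<^sub>R w) \<in> frontier D \<inter> U"
      unfolding p_def
      by (rule eventually_frontier_on_turned_line[OF assms(2,5) fr(1)[unfolded A] _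
            a(3)[unfolded A] _ ac UV(1) UV(3)[unfolded A]]) (use au in auto)
    have evB: "\<forall>\<^sub>F \<epsilon> in at_right 0. \<exists>s \<in> closed_segment (\<beta> / (1 + \<epsilon> * d)) (\<beta> / (1 + \<epsilon> * q)).
        P + s *\<^sub>R (u + \<epsilon> *\<^sub>R w) \<in> frontier D \<inter> V"
      unfolding q_def
      by (rule eventually_frontier_on_turned_line[OF assms(2,5) fr(2)[unfolded B] \<beta>'(1)
            b(3)[unfolded B] _ bd UV(2) UV(4)[unfolded B]]) (use bu in auto)
    have "\<forall>\<^sub>F \<epsilon> in at_right (0::real). 0 < \<epsilon>" by (rule eventually_at_right_less)
    \<comment> \<open>The filter is proper, so a contradiction for all small positive \<epsilon> is
      enough.\<close>
    then have "\<forall>\<^sub>F \<epsilon> in at_right (0::real). False"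
      using evA evB eventually_chord_growth[OF dc]
        eventually_one_plus_mult_pos[of p] eventually_one_plus_mult_pos[of d]
    proof eventually_elim
      case (elim \<epsilon>)
      define z where "z = u + \<epsilon> *\<^sub>R w"
      obtain r where r: "r \<in> closed_segment (1 / (1 + \<epsilon> * c)) (1 / (1 + \<epsilon> * p))"
        "P + r *\<^sub>R z \<in> frontier D \<inter> U" using elim(2) unfolding z_def by blast
      obtain s where s: "s \<in> closed_segment (\<beta> / (1 + \<epsilon> * d)) (\<beta> / (1 + \<epsilon> * q))"
        "P + s *\<^sub>R z \<in> frontier D \<inter> V" using elim(3) unfolding z_def by blast
      \<comment> \<open>These orders make the inward-segment parameters the lower bound for
        \<open>r\<close> and the upper bound for \<open>s\<close>, hence \<open>r - s\<close> is at
        least the quantity known to exceed \<open>1 - \<beta>\<close>.\<close>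
      have pc: "1 + \<epsilon> * p \<le> 1 + \<epsilon> * c" and dq: "1 + \<epsilon> * d \<le> 1 + \<epsilon> * q"
        using elim(1) \<eta> by (auto simp: c_def d_def)
      have "1 / (1 + \<epsilon> * c) \<le> 1 / (1 + \<epsilon> * p)"
        using pc elim(5) by (intro divide_left_mono) auto
      then have rlow: "1 / (1 + \<epsilon> * c) \<le> r" using r(1) by (simp add: closed_segment_eq_real_ivl)
      have "\<beta> / (1 + \<epsilon> * q) \<le> \<beta> / (1 + \<epsilon> * d)"
        using dq elim(6) \<beta>' by (intro divide_left_mono) auto
      then have sup: "s \<le> \<beta> / (1 + \<epsilon> * d)" and "\<beta> / (1 + \<epsilon> * q) \<le> s"
        using s(1) by (auto simp: closed_segment_eq_real_ivl split: if_splits)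
      moreover have "\<beta> / (1 + \<epsilon> * q) > 0" using dq elim(6) \<beta>' by simp
      ultimately have spos: "s > 0" by linarith
      have rs: "r - s > 1 - \<beta>" using rlow sup elim(4) by linarith
      then have "s < r" using \<beta>' by linarith
      then have "dist (P + r *\<^sub>R z) (P + s *\<^sub>R z) \<le> dist A B"
        using r(2) s(2) spos by (intro max chord_from_on_ray) auto
      moreover have "dist (P + r *\<^sub>R z) (P + s *\<^sub>R z) = (r - s) * norm z"
        using \<open>s < r\<close> by (simp add: dist_norm flip: scaleR_diff_left)
      moreover have "dist A B = (1 - \<beta>) * norm u"
      proof -
        have "A - B = (1 - \<beta>) *\<^sub>R u" by (simp add: A B algebra_simps)
        then show ?thesis using \<beta>' by (simp add: dist_norm)
      qed
      ultimately have le: "(r - s) * norm z \<le> (1 - \<beta>) * norm u" by linarith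
      \<comment> \<open>As \<open>w\<close> is orthogonal to \<open>u\<close>, turning never
        shortens the direction vector, so the gain in parameter is a gain in length.\<close>
      have "z \<bullet> z = u \<bullet> u + \<epsilon>\<^sup>2 * (w \<bullet> w)"
        using uw by (simp add: z_def inner_add_left inner_add_right inner_commute power2_eq_square)
      then have "norm u \<le> norm z" by (simp add: norm_le)
      then have "(r - s) * norm u \<le> (r - s) * norm z"
        using \<open>s < r\<close> by (intro mult_left_mono) auto
      moreover have "(1 - \<beta>) * norm u < (r - s) * norm u"
        using rs \<open>u \<noteq> 0\<close> by (intro mult_strict_right_mono) auto
      ultimately show False using le by linarith
    qed
    then show False by simp
  qed
  \<comment> \<open>Since \<open>a' \<bullet> u = 1\<close>, the factor
    \<open>N = u \<bullet> u\<close> places this point of the normal at \<open>A\<close> on the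
    hyperplane through \<open>P\<close>. The equation \<open>w = 0\<close>, scaled by
    \<open>N\<close>, rewrites it as a point of the normal at \<open>B\<close>.\<close>
  define x where "x = A - N *\<^sub>R a'"
  have "N *\<^sub>R w = 0" using w0 by simp
  then have "(N * \<beta>) *\<^sub>R b' - N *\<^sub>R a' + (1 - \<beta>) *\<^sub>R u = 0"
    using N by (simp add: w_def scaleR_add_right scaleR_diff_right)
  then have xB: "x = B - (N * \<beta>) *\<^sub>R b'"
    by (simp add: x_def A B algebra_simps)
  have "x = A + (- N / (a \<bullet> u)) *\<^sub>R a" by (simp add: x_def a'_def)
  then have "x \<in> normal_line \<Pi>1 A" unfolding a(2) normal_line_hyperplane[OF a(1)] by blast
  moreover have "x = B + (- (N * \<beta>) / (b \<bullet> u)) *\<^sub>R b" by (simp add: xB b'_def)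
  then have "x \<in> normal_line \<Pi>2 B" unfolding b(2) normal_line_hyperplane[OF b(1)] by blast
  moreover have "x \<in> orthogonal_hyperplane P A B"
  proof -
    have "(x - P) \<bullet> u = 0"
      using a'u by (simp add: x_def A inner_diff_left N_def inner_add_left)
    moreover have "A - B = (1 - \<beta>) *\<^sub>R u" by (simp add: A B algebra_simps)
    ultimately show ?thesis by (simp add: orthogonal_hyperplane_def orthogonal_def)
  qed
  ultimately show ?thesis by blast
qed

end
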